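(* For every integer $k\ge2$ and every integer $n\ge1$, $\rho_k(n)<n/(k-1)$ and $\sigma_k(n)<n(k+1)/(k-1)$.
   Context: Strings are indexed from 1. An integer $p\ge1$ is a period of $s$ if $s[m]=s[m+p]$ for all $1\le m\le |s|-p$. A run of a string $w$ of length $n$ is a triple $(i,j,p)$ with $1\le i\le j\le n$ such that $p$ is the smallest period of $w[i..j]$, $j-i+1\ge 2p$, ($i=1$ or $w[i-1]\ne w[i+p-1]$), and ($j=n$ or $w[j+1]\ne w[j-p+1]$); its exponent is $(j-i+1)/p$. $\rho_k(n)$ is the maximum number of runs with exponent at least $k$ in a string of length $n$, and $\sigma_k(n)$ is the maximum sum of exponents of runs with exponent at least $k$ in a string of length $n$. *)

theory Defs
  imports Complex_Main
begin

text \<open>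
  Strings over an alphabet \<^typ>\<open>'a\<close> are lists. Positions are counted from 1, so
  \<open>letter w m\<close> is meaningful for \<open>1 \<le> m \<le> length w\<close> and \<open>factor w i j\<close> (the substring
  \<open>w[i..j]\<close>) for \<open>1 \<le> i \<le> j \<le> length w\<close>.
\<close>

definition letter :: "'a list \<Rightarrow> nat \<Rightarrow> 'a"
  where "letter w m = w ! (m - 1)"

definition factor :: "'a list \<Rightarrow> nat \<Rightarrow> nat \<Rightarrow> 'a list"
  where "factor w i j = drop (i - 1) (take j w)"

text \<open>If \<open>p > length s\<close>, the truncated subtraction gives an empty range, so \<open>p\<close> is a period.\<close>

definition is_period :: "nat \<Rightarrow> 'a list \<Rightarrow> bool"
  where "is_period p s \<longleftrightarrow> p \<ge> 1 \<and> (\<forall>m\<in>{1..length s - p}. letter s m = letter s (m + p))"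

definition smallest_period :: "'a list \<Rightarrow> nat"
  where "smallest_period s = (LEAST p. is_period p s)"

definition runs :: "'a list \<Rightarrow> (nat \<times> nat \<times> nat) set"
  where "runs w = {(i, j, p).
     1 \<le> i \<and> i \<le> j \<and> j \<le> length w \<and>
     p = smallest_period (factor w i j) \<and>
     j - i + 1 \<ge> 2 * p \<and>
     (i = 1 \<or> letter w (i - 1) \<noteq> letter w (i + p - 1)) \<and>
     (j = length w \<or> letter w (j + 1) \<noteq> letter w (j - p + 1))}"

fun run_exponent :: "nat \<times> nat \<times> nat \<Rightarrow> real"
  where "run_exponent (i, j, p) = real (j - i + 1) / real p"

definition runs_ge :: "nat \<Rightarrow> 'a list \<Rightarrow> (nat \<times> nat \<times> nat) set"
  where "runs_ge k w = {r \<in> runs w. run_exponent r \<ge> real k}"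

text \<open>
  The alphabet is passed as a type argument. It may be infinite; the maxima are still taken
  over finite nonempty sets, as shown below.
\<close>

definition rho :: "'a itself \<Rightarrow> nat \<Rightarrow> nat \<Rightarrow> nat"
  where "rho _ k n = Max {card (runs_ge k w) | w :: 'a list. length w = n}"

definition sigma :: "'a itself \<Rightarrow> nat \<Rightarrow> nat \<Rightarrow> real"
  where "sigma _ k n = Max {(\<Sum>r\<in>runs_ge k w. run_exponent r) | w :: 'a list. length w = n}"

lemma is_period_smallest_period: "is_period (smallest_period s) s"
proof -
  have "is_period (Suc (length s)) s"
    by (simp add: is_period_def)
  then show ?thesis
    unfolding smallest_period_def by (rule LeastI)
qed

lemma runs_ge_subset: "runs_ge k w \<subseteq> {..length w} \<times> {..length w} \<times> {..length w}"
  by (auto simp: runs_ge_def runs_def)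

lemma finite_runs_ge: "finite (runs_ge k w)"
  using runs_ge_subset by (rule finite_subset) simp

lemma finite_image_runs_ge: "finite {f (runs_ge k w) | w :: 'a list. length w = n}"
proof (rule finite_subset)
  show "{f (runs_ge k w) | w :: 'a list. length w = n} \<subseteq> f ` Pow ({..n} \<times> {..n} \<times> {..n})"
    using runs_ge_subset by blast
qed simp

lemma image_runs_ge_nonempty: "{f (runs_ge k w) | w :: 'a list. length w = n} \<noteq> {}"
  using length_replicate[of n "undefined :: 'a"] by blast

lemma rho_attained: "\<exists>w :: 'a list. length w = n \<and> rho TYPE('a) k n = card (runs_ge k w)"
  using Max_in[OF finite_image_runs_ge[where 'a = 'a and f = card and k = k and n = n]
      image_runs_ge_nonempty]
  by (auto simp: rho_def)

lemma sigma_attained: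
  "\<exists>w :: 'a list. length w = n \<and> sigma TYPE('a) k n = (\<Sum>r\<in>runs_ge k w. run_exponent r)"
  using Max_in[OF finite_image_runs_ge[where 'a = 'a and f = "sum run_exponent" and k = k and n = n]
      image_runs_ge_nonempty]
  by (auto simp: sigma_def)

end

theory Submission
  imports Defs
begin

text \<open>
  This is the proof by Bannai et al., with Lyndon words replaced by suffix comparison.
  Encode a string as an integer sequence \<open>c\<close> with a sentinel outside \<open>1..n\<close>, and orient every run so that the letter following it is smaller than the
  one its period predicts, replacing \<open>c\<close> by \<open>-c\<close> if necessary. The starting positions \<open>t > i\<close> in
  a run \<open>(i, j, p)\<close> whose next smaller suffix is exactly \<open>t + p\<close> (the starts of the Lyndon roots)
  occur once in each window of \<open>p\<close> consecutive positions, so a run of exponent \<open>e\<close> owns at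
  least \<open>\<lfloor>e\<rfloor> - 1\<close> of them. No position is owned by two runs, and position 1 by none. Hence
  \<open>\<rho> (k - 1) \<le> n - 1\<close>, and the exponents sum to at most \<open>n - 1 + 2 \<rho>\<close>.
\<close>

section \<open>Lexicographic order on suffixes of sequences\<close>

text \<open>Sequences are infinite, so a comparison is always decided at a mismatch and the case of
  a proper prefix never arises.\<close>

definition lex_less :: "(nat \<Rightarrow> int) \<Rightarrow> (nat \<Rightarrow> int) \<Rightarrow> bool"
  where "lex_less f g \<longleftrightarrow> (\<exists>l. (\<forall>x<l. f x = g x) \<and> f l < g l)"

definition suf :: "(nat \<Rightarrow> int) \<Rightarrow> nat \<Rightarrow> nat \<Rightarrow> int"
  where "suf c t = (\<lambda>x. c (t + x))"

lemma suf_apply [simp]: "suf c t x = c (t + x)"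
  by (simp add: suf_def)

lemma lex_lessI: "(\<And>x. x < l \<Longrightarrow> f x = g x) \<Longrightarrow> f l < g l \<Longrightarrow> lex_less f g"
  by (auto simp: lex_less_def)

lemma lex_less_trans:
  assumes "lex_less f g" "lex_less g h"
  shows "lex_less f h"
proof -
  obtain l where l: "\<forall>x<l. f x = g x" "f l < g l"
    using assms(1) by (auto simp: lex_less_def)
  obtain m where m: "\<forall>x<m. g x = h x" "g m < h m"
    using assms(2) by (auto simp: lex_less_def)
  show ?thesis
    by (rule lex_lessI[of "min l m"]) (use l m in \<open>cases l m rule: linorder_cases; force\<close>)+
qed

lemma lex_less_irrefl: "\<not> lex_less f f"
  by (simp add: lex_less_def)

lemma lex_less_asym: "lex_less f g \<Longrightarrow> \<not> lex_less g f"
  using lex_less_trans lex_less_irrefl by blast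

lemma lex_less_linear: "lex_less f g \<or> f = g \<or> lex_less g f"
proof (cases "f = g")
  case False
  then have "\<exists>x. f x \<noteq> g x" by auto
  then obtain l where l: "f l \<noteq> g l" "\<And>x. x < l \<Longrightarrow> f x = g x"
    using exists_least_iff[of "\<lambda>x. f x \<noteq> g x"] by blast
  show ?thesis
    using lex_lessI[of l f g] lex_lessI[of l g f] l by (cases "f l < g l") auto
qed simp

text \<open>In terms of words, \<open>p\<close> is the length of the longest Lyndon word that starts
  at \<open>t\<close>.\<close>

definition next_smaller_suffix :: "(nat \<Rightarrow> int) \<Rightarrow> nat \<Rightarrow> nat \<Rightarrow> bool"
  where "next_smaller_suffix c t p \<longleftrightarrow> 1 \<le> p \<and>
     (\<forall>q\<in>{1..<p}. lex_less (suf c t) (suf c (t + q))) \<and> lex_less (suf c (t + p)) (suf c t)"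

lemma next_smaller_suffix_unique:
  assumes "next_smaller_suffix c t p" "next_smaller_suffix c t q"
  shows "p = q"
proof (rule ccontr)
  assume "p \<noteq> q"
  then have "p \<in> {1..<q} \<or> q \<in> {1..<p}"
    using assms by (auto simp: next_smaller_suffix_def)
  then show False
    using assms lex_less_asym unfolding next_smaller_suffix_def by blast
qed

lemma next_smaller_suffix_1:
  assumes "next_smaller_suffix c t p" "lex_less (suf c (t + 1)) (suf c t)"
  shows "p = 1"
  using assms by (intro next_smaller_suffix_unique[of c t]) (auto simp: next_smaller_suffix_def)

text \<open>The counterpart of the fact that a Lyndon word of length at least 2 does not end with its
  first letter.\<close>

lemma next_smaller_suffix_last_letter:
  assumes "next_smaller_suffix c t p" "p \<noteq> 1"
  shows "c (t + p - 1) \<noteq> c t"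
proof
  assume eq: "c (t + p - 1) = c t"
  have p: "1 \<in> {1..<p}" "p - 1 \<in> {1..<p}"
    using assms by (auto simp: next_smaller_suffix_def)
  then have *: "lex_less (suf c t) (suf c (t + 1))" "lex_less (suf c t) (suf c (t + (p - 1)))"
    "lex_less (suf c (t + p)) (suf c t)"
    using assms(1) unfolding next_smaller_suffix_def by blast+
  obtain l where l: "\<forall>x<l. c (t + x) = c (t + (p - 1) + x)" "c (t + l) < c (t + (p - 1) + l)"
    using *(2) by (auto simp: lex_less_def)
  have "l \<noteq> 0" using l(2) eq p by (intro notI) auto
  then obtain l' where l': "l = Suc l'" by (cases l) auto
  have shift: "t + (p - 1) + Suc x = t + p + x" for x
    using p by simp
  \<comment> \<open>Removing the equal first letters from the comparison of the suffixes at
    \<open>t\<close> and \<open>t + p - 1\<close> closes a cycle: suffix \<open>t + 1\<close> <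
    suffix \<open>t + p\<close> < suffix \<open>t\<close> < suffix \<open>t + 1\<close>.\<close>
  have "lex_less (suf c (t + 1)) (suf c (t + p))"
  proof (rule lex_lessI[of l'])
    show "suf c (t + 1) x = suf c (t + p) x" if "x < l'" for x
      using l(1)[rule_format, of "Suc x"] that l' shift[of x] by simp
    show "suf c (t + 1) l' < suf c (t + p) l'"
      using l(2) l' shift[of l'] by simp
  qed
  with *(1,3) show False
    using lex_less_trans lex_less_irrefl by blast
qed

text \<open>The first letter after \<open>t\<close> that differs from \<open>c t\<close> is smaller
  in one of the two orders. In that order the suffix at \<open>t + 1\<close> is already smaller than
  the one at \<open>t\<close>.\<close>

lemma next_smaller_suffix_opposite:
  assumes "next_smaller_suffix c t p" "next_smaller_suffix (\<lambda>x. - c x) t q"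
    and "u > t" "c u \<noteq> c t"
  shows "p = 1 \<or> q = 1"
proof -
  have "\<exists>y. c (t + Suc y) \<noteq> c t"
    using assms(3,4) by (metis less_imp_Suc_add add_Suc_right)
  then obtain y where y: "c (t + Suc y) \<noteq> c t" "\<And>x. x < y \<Longrightarrow> c (t + Suc x) = c t"
    using exists_least_iff[of "\<lambda>y. c (t + Suc y) \<noteq> c t"] by blast
  have eq: "c (t + x) = c t" if "x \<le> y" for x
    using that y(2)[of "x - 1"] by (cases x) auto
  show ?thesis
  proof (cases "c (t + Suc y) < c t")
    case True
    have "lex_less (suf c (t + 1)) (suf c t)"
      by (rule lex_lessI[of y]) (use True y(2) eq in auto)
    then show ?thesis using assms(1) next_smaller_suffix_1 by blast
  next
    case False
    have "lex_less (suf (\<lambda>x. - c x) (t + 1)) (suf (\<lambda>x. - c x) t)"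
      by (rule lex_lessI[of y]) (use False y(1,2) eq in auto)
    then show ?thesis using assms(2) next_smaller_suffix_1 by blast
  qed
qed

section \<open>Runs of integer sequences\<close>

definition periodic_on :: "(nat \<Rightarrow> 'a) \<Rightarrow> nat \<Rightarrow> nat \<Rightarrow> nat \<Rightarrow> bool"
  where "periodic_on c i j p \<longleftrightarrow> (\<forall>x. i \<le> x \<and> x + p \<le> j \<longrightarrow> c x = c (x + p))"

text \<open>Both ends must be broken by a mismatch, also at the borders of a string: there the
  sentinel of \<open>coded\<close> supplies it, on the left at position 0.\<close>

definition seq_run :: "(nat \<Rightarrow> int) \<Rightarrow> nat \<Rightarrow> nat \<Rightarrow> nat \<Rightarrow> bool"
  where "seq_run c i j p \<longleftrightarrow> 1 \<le> i \<and> 1 \<le> p \<and> i + 2 * p \<le> j + 1 \<and> periodic_on c i j p \<and>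
     (\<forall>q\<in>{1..<p}. \<not> periodic_on c i j q) \<and>
     c (i - 1) \<noteq> c (i - 1 + p) \<and> c (j + 1) \<noteq> c (j + 1 - p)"

lemma seq_run_uminus: "seq_run (\<lambda>x. - c x) i j p \<longleftrightarrow> seq_run c i j p"
  by (simp add: seq_run_def periodic_on_def)

lemma periodic_on_mult:
  assumes "periodic_on c i j p" "i \<le> x" "x + m * p \<le> j"
  shows "c (x + m * p) = c x"
  using assms(3)
proof (induction m)
  case (Suc m)
  have "c (x + m * p) = c (x + m * p + p)"
    using assms(1,2) Suc.prems unfolding periodic_on_def by auto
  with Suc show ?case by (simp add: algebra_simps)
qed simp

lemma periodic_on_mod:
  assumes "periodic_on c i j p" "i \<le> x" "x \<le> j"
  shows "c (i + (x - i) mod p) = c x"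
proof -
  have "x = i + (x - i) mod p + (x - i) div p * p"
    using assms(2) by simp
  then show ?thesis
    using periodic_on_mult[OF assms(1), of "i + (x - i) mod p" "(x - i) div p"] assms(3) by simp
qed

text \<open>The witness \<open>t\<close> starts the least rotation of the period among
  \<open>p\<close> consecutive ones. The bound on \<open>a\<close> ensures
  \<open>t + p \<le> j + 1\<close>, so that the root starting at \<open>t\<close> lies inside the
  run.\<close>

lemma seq_run_window:
  assumes run: "seq_run c i j p" and desc: "c (j + 1) < c (j + 1 - p)"
    and a: "i \<le> a" "a + 2 * p \<le> j + 2"
  shows "\<exists>t\<in>{a..<a + p}. next_smaller_suffix c t p"
proof -
  have p: "1 \<le> p" and per: "periodic_on c i j p"
    and prim: "\<And>q. q \<in> {1..<p} \<Longrightarrow> \<not> periodic_on c i j q"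
    using run by (auto simp: seq_run_def)
  \<comment> \<open>\<open>g\<close> continues the run periodically to the right for ever, so its
    suffixes compare rotations undisturbed by the end of the run.\<close>
  define g where "g x = c (i + (x - i) mod p)" for x
  have g_eq: "g x = c x" if "i \<le> x" "x \<le> j" for x
    using periodic_on_mod[OF per that] by (simp add: g_def)
  have g_mult: "g (x + m * p) = g x" if "i \<le> x" for x m
  proof -
    have "x + m * p - i = x - i + m * p" using that by simp
    then show ?thesis by (simp add: g_def)
  qed
  have g_suf: "suf g (x + p) = suf g x" if "i \<le> x" for x
    using that g_mult[of "x + _" 1] by (auto simp: fun_eq_iff algebra_simps)
  obtain t where t: "t \<in> {a..<a + p}"
    and min: "\<And>s. s \<in> {a..<a + p} \<Longrightarrow> s \<noteq> t \<Longrightarrow> \<not> lex_less (suf g s) (suf g t)"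
  proof -
    have "\<exists>m\<in>{a..<a + p}. \<forall>x\<in>{a..<a + p}. x \<noteq> m \<longrightarrow> \<not> lex_less (suf g x) (suf g m)"
      by (rule Finite_Set.bex_min_element)
        (use p in \<open>auto simp: asymp_on_def transp_on_def dest: lex_less_asym intro: lex_less_trans\<close>)
    then show ?thesis using that by blast
  qed
  have it: "i \<le> t" "t + p \<le> j + 1" using t a by auto
  have min': "\<not> lex_less (suf g (t + q)) (suf g t)" if q: "q \<in> {1..<p}" for q
  proof (cases "t + q < a + p")
    case True
    then show ?thesis using min[of "t + q"] t q by auto
  next
    case False
    then have "suf g (t + q) = suf g (t + q - p)" "t + q - p \<in> {a..<a + p}" "t + q - p \<noteq> t"
      using g_suf[of "t + q - p"] t q a by auto
    then show ?thesis using min by simp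
  qed
  have "lex_less (suf c t) (suf c (t + q))" if q: "q \<in> {1..<p}" for q
  proof -
    have "suf g t \<noteq> suf g (t + q)"
    proof
      assume eq: "suf g t = suf g (t + q)"
      have "periodic_on c i j q"
        unfolding periodic_on_def
      proof (intro allI impI)
        fix x assume x: "i \<le> x \<and> x + q \<le> j"
        \<comment> \<open>Adding a multiple of \<open>p\<close> carries \<open>x\<close> to or
          beyond \<open>t\<close>, where the equality of the two suffixes of \<open>g\<close> can be
          read off.\<close>
        have "t \<le> x + t * p" using p by (simp add: trans_le_add2)
        then obtain y where y: "x + t * p = t + y" using le_Suc_ex by blast
        have "c x = g (x + t * p)" using x g_eq g_mult by simp
        also have "\<dots> = g (t + q + y)" using y fun_cong[OF eq, of y] by simp
        also have "t + q + y = x + q + t * p" using y by simp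
        also have "g \<dots> = c (x + q)" using x g_eq g_mult by simp
        finally show "c x = c (x + q)" .
      qed
      with prim[OF q] show False ..
    qed
    with min'[OF q] have "lex_less (suf g t) (suf g (t + q))"
      using lex_less_linear by blast
    then obtain l where l: "\<And>x. x < l \<Longrightarrow> g (t + x) = g (t + q + x)" "g (t + l) < g (t + q + l)"
      by (auto simp: lex_less_def)
    text \<open>Otherwise the rotation starting at \<open>t + (p - q)\<close> would be smaller than the one at \<open>t\<close>, so the
      first mismatch lies inside the run, where \<open>g\<close> agrees with \<open>c\<close>.\<close>
    have "l < p - q"
    proof (rule ccontr)
      assume neg: "\<not> l < p - q"
      have "lex_less (suf g (t + (p - q))) (suf g (t + p))"
      proof (rule lex_lessI[of "l - (p - q)"])
        show "suf g (t + (p - q)) x = suf g (t + p) x" if "x < l - (p - q)" for x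
        proof -
          have "p - q + x < l" "t + q + (p - q + x) = t + p + x" using that q by auto
          then show ?thesis using l(1)[of "p - q + x"] by (simp add: add.assoc)
        qed
        show "suf g (t + (p - q)) (l - (p - q)) < suf g (t + p) (l - (p - q))"
          using l(2) q neg by (simp add: algebra_simps)
      qed
      moreover have "p - q \<in> {1..<p}" using q by auto
      ultimately show False
        using g_suf[OF it(1)] min' by simp
    qed
    then show ?thesis
      using l it q by (intro lex_lessI[of l]) (auto simp: g_eq)
  qed
  \<comment> \<open>The period makes the two suffixes agree until the first one reaches
    \<open>j + 1\<close>, where \<open>desc\<close> provides the smaller letter.\<close>
  moreover have "lex_less (suf c (t + p)) (suf c t)"
  proof (rule lex_lessI[of "j + 1 - p - t"])
    show "suf c (t + p) x = suf c t x" if "x < j + 1 - p - t" for x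
      using per that it unfolding periodic_on_def by (auto simp: algebra_simps)
    show "suf c (t + p) (j + 1 - p - t) < suf c t (j + 1 - p - t)"
      using desc it by simp
  qed
  ultimately show ?thesis
    using t p unfolding next_smaller_suffix_def by blast
qed

text \<open>If the runs differed at one end, the mismatch that stops one of them there would join
  two positions at distance \<open>p\<close> inside the other, since both contain the positions from
  \<open>t - 1\<close> to \<open>t + p - 1\<close>.\<close>

lemma seq_run_eqI:
  assumes "seq_run c i j p" "seq_run c i' j' p"
    and "i < t" "t + p \<le> j + 1" "i' < t" "t + p \<le> j' + 1"
  shows "i = i' \<and> j = j'"
proof -
  have "\<not> j < j'" if "seq_run c i j p" "seq_run c i' j' p" "t + p \<le> j + 1" "i' < t" for i j i' j'
  proof
    assume "j < j'"
    then have "i' \<le> j + 1 - p" "j + 1 - p + p \<le> j'" using that(3,4) by auto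
    then have "c (j + 1 - p) = c (j + 1 - p + p)"
      using that(2) unfolding seq_run_def periodic_on_def by blast
    moreover have "c (j + 1) \<noteq> c (j + 1 - p)" "j + 1 - p + p = j + 1"
      using that by (auto simp: seq_run_def)
    ultimately show False by simp
  qed
  moreover have "\<not> i' < i" if "seq_run c i j p" "seq_run c i' j' p" "i < t" "t + p \<le> j' + 1"
    for i j i' j'
  proof
    assume "i' < i"
    then have "i' \<le> i - 1" "i - 1 + p \<le> j'" using that(3,4) by auto
    then have "c (i - 1) = c (i - 1 + p)"
      using that(2) unfolding seq_run_def periodic_on_def by blast
    then show False using that by (simp add: seq_run_def)
  qed
  ultimately have "\<not> j < j'" "\<not> j' < j" "\<not> i < i'" "\<not> i' < i"
    using assms by blast+
  then show ?thesis by simp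
qed

section \<open>Starts of Lyndon roots: their number in one run, and disjointness for different
  runs\<close>

definition oriented :: "(nat \<Rightarrow> int) \<Rightarrow> nat \<Rightarrow> nat \<Rightarrow> nat \<Rightarrow> int"
  where "oriented c j p = (if c (j + 1) < c (j + 1 - p) then c else (\<lambda>x. - c x))"

text \<open>Strictness in \<open>i < t\<close> keeps \<open>t - 1\<close> inside the run, whence
  \<open>c (t - 1) = c (t + p - 1)\<close>; disjointness rests on this.\<close>

fun root_starts :: "(nat \<Rightarrow> int) \<Rightarrow> nat \<times> nat \<times> nat \<Rightarrow> nat set"
  where "root_starts c (i, j, p) =
     {t. i < t \<and> t + p \<le> j + 1 \<and> next_smaller_suffix (oriented c j p) t p}"

lemma finite_root_starts: "finite (root_starts c r)"
proof (cases r)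
  case (fields i j p)
  then have "root_starts c r \<subseteq> {..j + 1}" by auto
  then show ?thesis by (rule finite_subset) simp
qed

text \<open>Cut the positions from \<open>i + 1\<close> on into blocks of length \<open>p\<close>.
  Block \<open>m\<close> contains a root start whenever \<open>(m + 2) * p\<close> is at most the
  length of the run, and the map below sends a root start to the index of its block.\<close>

lemma card_root_starts:
  assumes "seq_run c i j p"
  shows "(j + 1 - i) div p - 1 \<le> card (root_starts c (i, j, p))"
proof -
  have p: "1 \<le> p" using assms by (simp add: seq_run_def)
  have run: "seq_run (oriented c j p) i j p"
    using assms by (simp add: oriented_def seq_run_uminus)
  have desc: "oriented c j p (j + 1) < oriented c j p (j + 1 - p)"
    using assms by (auto simp: oriented_def seq_run_def)
  let ?N = "(j + 1 - i) div p - 1"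
  have "{..<?N} \<subseteq> (\<lambda>t. (t - (i + 1)) div p) ` root_starts c (i, j, p)"
  proof
    fix m assume "m \<in> {..<?N}"
    then have "m + 2 \<le> (j + 1 - i) div p" by simp
    then have "(m + 2) * p \<le> j + 1 - i"
      using p by (simp add: less_eq_div_iff_mult_less_eq)
    then have m: "m * p + 2 * p \<le> j + 1 - i"
      by (simp add: algebra_simps)
    have "i + 1 + m * p + 2 * p \<le> j + 2" using m p by linarith
    then obtain t where t: "t \<in> {i + 1 + m * p..<i + 1 + m * p + p}"
      "next_smaller_suffix (oriented c j p) t p"
      using seq_run_window[OF run desc, of "i + 1 + m * p"] by auto
    have "(t - (i + 1)) div p = m"
    proof (rule div_nat_eqI)
      show "p * m \<le> t - (i + 1)" using t(1) by (auto simp: mult.commute)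
      show "t - (i + 1) < p * Suc m" using t(1) p by (auto simp: mult.commute)
    qed
    moreover have "t \<in> root_starts c (i, j, p)"
      using t m by auto
    ultimately show "m \<in> (\<lambda>t. (t - (i + 1)) div p) ` root_starts c (i, j, p)"
      by blast
  qed
  from surj_card_le[OF finite_root_starts this] show ?thesis by simp
qed

text \<open>Opposite orders force one period to be 1. Both roots end with the letter
  \<open>c (t - 1)\<close>, so the other root ends with its own first letter and has length 1
  too.\<close>

lemma next_smaller_suffix_mixed_runs:
  assumes "seq_run c i j p" "seq_run c i' j' p'"
    and "i < t" "t + p \<le> j + 1" "i' < t" "t + p' \<le> j' + 1"
    and "next_smaller_suffix c t p" "next_smaller_suffix (\<lambda>x. - c x) t p'"
  shows "p = p'"
proof -
  have prev: "c (t - 1) = c (t + p - 1)"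
    if "seq_run c i j p" "i < t" "t + p \<le> j + 1" for i j p
  proof -
    have "i \<le> t - 1" "t - 1 + p \<le> j" "t - 1 + p = t + p - 1" using that by auto
    then show ?thesis
      using that unfolding seq_run_def periodic_on_def by metis
  qed
  have eq: "c (t + p - 1) = c (t + p' - 1)"
    using prev[OF assms(1,3,4)] prev[OF assms(2,5,6)] by simp
  \<comment> \<open>The break of the first run supplies \<open>u\<close>: its two letters differ,
    and neither stands before \<open>t\<close>.\<close>
  have "\<exists>u>t. c u \<noteq> c t"
  proof (cases "c (j + 1) = c t")
    case True
    then have "c (j + 1 - p) \<noteq> c t" using assms(1) by (simp add: seq_run_def)
    moreover from this have "j + 1 - p > t" using assms(4) by (metis add_le_imp_le_diff le_neq_implies_less)
    ultimately show ?thesis by blast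
  next
    case False
    moreover have "j + 1 > t" using assms(1,4) by (auto simp: seq_run_def)
    ultimately show ?thesis by blast
  qed
  then consider "p = 1" | "p' = 1"
    using next_smaller_suffix_opposite[OF assms(7,8)] by blast
  then show ?thesis
  proof cases
    case 1
    then show ?thesis using next_smaller_suffix_last_letter[OF assms(8)] eq by auto
  next
    case 2
    then show ?thesis using next_smaller_suffix_last_letter[OF assms(7)] eq by auto
  qed
qed

lemma root_starts_disjoint:
  assumes "seq_run c i j p" "seq_run c i' j' p'"
    and "t \<in> root_starts c (i, j, p)" "t \<in> root_starts c (i', j', p')"
  shows "(i, j, p) = (i', j', p')"
proof -
  have t: "i < t" "t + p \<le> j + 1" "i' < t" "t + p' \<le> j' + 1"
    "next_smaller_suffix (oriented c j p) t p" "next_smaller_suffix (oriented c j' p') t p'"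
    using assms(3,4) by auto
  have "p = p'"
    using t next_smaller_suffix_unique
      next_smaller_suffix_mixed_runs[OF assms(1,2) t(1-4)]
      next_smaller_suffix_mixed_runs[OF assms(2,1) t(3,4,1,2)]
    by (auto simp: oriented_def split: if_splits)
  then show ?thesis
    using seq_run_eqI[of c i j p i' j' t] assms(1,2) t by auto
qed

section \<open>Runs of strings\<close>

lemma is_period_factor:
  assumes "1 \<le> i" "i \<le> j" "j \<le> length w"
  shows "is_period p (factor w i j) \<longleftrightarrow> 1 \<le> p \<and> periodic_on (letter w) i j p"
proof -
  have len: "length (factor w i j) = j + 1 - i"
    using assms by (simp add: factor_def)
  have letter: "letter (factor w i j) m = letter w (i + m - 1)" if "1 \<le> m" "m \<le> j + 1 - i" for m
  proof -
    have "i - 1 + (m - 1) = i + m - 1 - 1" "m - 1 < j - (i - 1)" using that assms by auto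
    then show ?thesis using assms by (simp add: letter_def factor_def)
  qed
  have "(\<forall>m\<in>{1..j + 1 - i - p}. letter (factor w i j) m = letter (factor w i j) (m + p)) \<longleftrightarrow>
      periodic_on (letter w) i j p" (is "?L \<longleftrightarrow> ?R")
  proof
    assume L: ?L
    show ?R
      unfolding periodic_on_def
    proof (intro allI impI)
      fix x assume x: "i \<le> x \<and> x + p \<le> j"
      define m where "m = x + 1 - i"
      have m: "m \<in> {1..j + 1 - i - p}" "i + m - 1 = x" "i + (m + p) - 1 = x + p"
        using x by (auto simp: m_def)
      then show "letter w x = letter w (x + p)"
        using bspec[OF L m(1)] letter[of m] letter[of "m + p"] by auto
    qed
  next
    assume R: ?R
    show ?L
    proof
      fix m assume m: "m \<in> {1..j + 1 - i - p}"
      then have "i \<le> i + m - 1 \<and> i + m - 1 + p \<le> j" "i + m - 1 + p = i + (m + p) - 1" by auto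
      then have "letter w (i + m - 1) = letter w (i + (m + p) - 1)"
        using R unfolding periodic_on_def by metis
      then show "letter (factor w i j) m = letter (factor w i j) (m + p)"
        using letter[of m] letter[of "m + p"] m by auto
    qed
  qed
  then show ?thesis by (simp add: is_period_def len)
qed

text \<open>Codes of letters are nonnegative, so the sentinel -1 differs from all of them.\<close>

definition coded :: "('a \<Rightarrow> nat) \<Rightarrow> 'a list \<Rightarrow> nat \<Rightarrow> int"
  where "coded f w m = (if 1 \<le> m \<and> m \<le> length w then int (f (letter w m)) else - 1)"

lemma coded_eq_iff:
  assumes "inj_on f (set w)" "1 \<le> x" "x \<le> length w" "1 \<le> y" "y \<le> length w"
  shows "coded f w x = coded f w y \<longleftrightarrow> letter w x = letter w y"
proof -
  have "letter w x \<in> set w" "letter w y \<in> set w"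
    using assms by (auto simp: letter_def)
  then show ?thesis
    using assms by (simp add: coded_def inj_on_eq_iff)
qed

lemma seq_run_coded:
  assumes inj: "inj_on f (set w)" and run: "(i, j, p) \<in> runs w"
  shows "seq_run (coded f w) i j p"
proof -
  let ?c = "coded f w"
  have r: "1 \<le> i" "i \<le> j" "j \<le> length w" "p = smallest_period (factor w i j)"
    "j - i + 1 \<ge> 2 * p" "i = 1 \<or> letter w (i - 1) \<noteq> letter w (i + p - 1)"
    "j = length w \<or> letter w (j + 1) \<noteq> letter w (j - p + 1)"
    using run by (auto simp: runs_def)
  have periodic: "periodic_on ?c i j q \<longleftrightarrow> periodic_on (letter w) i j q" for q
    using coded_eq_iff[OF inj] r unfolding periodic_on_def
    by (smt (verit, best) le_add1 le_trans)
  have p: "1 \<le> p" "periodic_on ?c i j p"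
    using is_period_smallest_period[of "factor w i j"] is_period_factor[OF r(1-3)] r(4) periodic
    by auto
  have "\<not> periodic_on ?c i j q" if "q \<in> {1..<p}" for q
    using that is_period_factor[OF r(1-3), of q] periodic r(4)
      not_less_Least[of q "\<lambda>q. is_period q (factor w i j)"]
    by (auto simp: smallest_period_def)
  moreover have "i + 2 * p \<le> j + 1" using r by simp
  moreover have "?c (i - 1) \<noteq> ?c (i - 1 + p)"
  proof (cases "i = 1")
    case True
    then show ?thesis using p r by (simp add: coded_def)
  next
    case False
    then have "i - 1 + p = i + p - 1" "1 \<le> i - 1" "i - 1 \<le> length w" "i - 1 + p \<le> length w"
      using r by auto
    then show ?thesis using False r(6) coded_eq_iff[OF inj, of "i - 1" "i - 1 + p"] by simp
  qed
  moreover have "?c (j + 1) \<noteq> ?c (j + 1 - p)"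
  proof (cases "j = length w")
    case True
    have "1 \<le> j + 1 - p" "j + 1 - p \<le> length w" using p r by auto
    then have "?c (j + 1 - p) \<ge> 0" by (simp add: coded_def)
    moreover have "?c (j + 1) = - 1" using True by (simp add: coded_def)
    ultimately show ?thesis by simp
  next
    case False
    then have "j + 1 - p = j - p + 1" "1 \<le> j - p + 1" "j - p + 1 \<le> length w" "j + 1 \<le> length w"
      using r by auto
    then show ?thesis using False r(7) coded_eq_iff[OF inj, of "j + 1" "j + 1 - p"] by simp
  qed
  ultimately show ?thesis
    using p r by (simp add: seq_run_def)
qed

section \<open>Counting root starts over all runs of a string\<close>

lemma root_starts_run_subset:
  assumes "inj_on f (set w)" "r \<in> runs w"
  shows "root_starts (coded f w) r \<subseteq> {2..length w}"
proof -
  obtain i j p where r: "r = (i, j, p)" by (cases r)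
  then have "seq_run (coded f w) i j p" "j \<le> length w"
    using assms seq_run_coded[OF assms(1)] by (blast, simp add: runs_def)
  then show ?thesis by (auto simp: r seq_run_def)
qed

text \<open>Disjoint sets of positions are added up. That position 1 is missing from all of them
  yields the strict inequalities later.\<close>

lemma sum_card_root_starts:
  assumes inj: "inj_on f (set w)" and R: "R \<subseteq> runs w" "finite R"
  shows "(\<Sum>r\<in>R. card (root_starts (coded f w) r)) \<le> length w - 1"
proof -
  have "(\<Sum>r\<in>R. card (root_starts (coded f w) r)) = card (\<Union>r\<in>R. root_starts (coded f w) r)"
  proof (rule card_UN_disjoint[symmetric])
    show "\<forall>r\<in>R. \<forall>s\<in>R. r \<noteq> s \<longrightarrow> root_starts (coded f w) r \<inter> root_starts (coded f w) s = {}"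
    proof (intro ballI impI)
      fix r s assume rs: "r \<in> R" "s \<in> R" "r \<noteq> s"
      obtain i j p i' j' p' where eq: "r = (i, j, p)" "s = (i', j', p')" by (cases r, cases s)
      have "seq_run (coded f w) i j p" "seq_run (coded f w) i' j' p'"
        using seq_run_coded[OF inj] rs R(1) eq by auto
      from root_starts_disjoint[OF this] rs(3) eq
      show "root_starts (coded f w) r \<inter> root_starts (coded f w) s = {}" by blast
    qed
  qed (use R(2) finite_root_starts in auto)
  also have "\<dots> \<le> card {2..length w}"
    using root_starts_run_subset[OF inj] R(1) by (intro card_mono) blast+
  finally show ?thesis by simp
qed

text \<open>Of the 2, one unit pays for rounding the exponent down and one for the block lost in
  \<open>card_root_starts\<close>.\<close>

lemma card_root_starts_exponent:
  assumes inj: "inj_on f (set w)" and r: "r \<in> runs w"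
  shows "run_exponent r < real (card (root_starts (coded f w) r)) + 2"
    and "run_exponent r \<ge> real k \<Longrightarrow> k - 1 \<le> card (root_starts (coded f w) r)"
proof -
  obtain i j p where eq: "r = (i, j, p)" by (cases r)
  then have run: "seq_run (coded f w) i j p" and ij: "i \<le> j"
    using seq_run_coded[OF inj] r by (blast, simp add: runs_def)
  have p: "0 < p" using run by (simp add: seq_run_def)
  let ?L = "j + 1 - i"
  have e: "run_exponent r = real ?L / real p" using eq ij by (simp add: Suc_diff_le)
  have card: "?L div p - 1 \<le> card (root_starts (coded f w) r)"
    using card_root_starts[OF run] eq by simp
  have "?L < (?L div p + 1) * p"
    using p by (simp add: dividend_less_div_times)
  also have "\<dots> \<le> (card (root_starts (coded f w) r) + 2) * p"
    using card by (intro mult_right_mono) auto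
  finally have "real ?L < real ((card (root_starts (coded f w) r) + 2) * p)"
    by (rule less_imp_of_nat_less)
  then show "run_exponent r < real (card (root_starts (coded f w) r)) + 2"
    using p by (simp add: e pos_divide_less_eq algebra_simps del: of_nat_diff)
  assume "run_exponent r \<ge> real k"
  then have "real (k * p) \<le> real ?L"
    using p by (simp add: e pos_le_divide_eq del: of_nat_diff)
  then have "k * p \<le> ?L" by (rule of_nat_le_iff[THEN iffD1])
  then have "k \<le> ?L div p" using p by (simp add: less_eq_div_iff_mult_less_eq)
  with card show "k - 1 \<le> card (root_starts (coded f w) r)" by simp
qed

lemma runs_ge_bounds:
  fixes w :: "'a list"
  assumes "w \<noteq> []"
  shows "(k - 1) * card (runs_ge k w) < length w"
    and "(\<Sum>r\<in>runs_ge k w. run_exponent r) < real (length w) + 2 * real (card (runs_ge k w))"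
proof -
  obtain f :: "'a \<Rightarrow> nat" where inj: "inj_on f (set w)"
    using finite_imp_inj_to_nat_seg[of "set w"] by auto
  define b where "b r = card (root_starts (coded f w) r)" for r
  have len: "length w > 0" using assms by simp
  have sum: "(\<Sum>r\<in>runs_ge k w. b r) \<le> length w - 1"
    unfolding b_def using sum_card_root_starts[OF inj _ finite_runs_ge, of k]
    by (auto simp: runs_ge_def)
  have "(k - 1) * card (runs_ge k w) = (\<Sum>r\<in>runs_ge k w. k - 1)" by simp
  also have "\<dots> \<le> (\<Sum>r\<in>runs_ge k w. b r)"
    unfolding b_def
    by (intro sum_mono card_root_starts_exponent(2)[OF inj]) (auto simp: runs_ge_def)
  finally show "(k - 1) * card (runs_ge k w) < length w" using sum len by linarith
  \<comment> \<open>Only a weak inequality holds here, as there may be no runs; strictness comes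
    from the \<open>length w - 1\<close> in \<open>sum\<close>.\<close>
  have "(\<Sum>r\<in>runs_ge k w. run_exponent r) \<le> (\<Sum>r\<in>runs_ge k w. real (b r) + 2)"
    unfolding b_def
    by (intro sum_mono less_imp_le card_root_starts_exponent(1)[OF inj]) (auto simp: runs_ge_def)
  also have "\<dots> = real (\<Sum>r\<in>runs_ge k w. b r) + 2 * real (card (runs_ge k w))"
    by (simp add: sum.distrib)
  also have "\<dots> < real (length w) + 2 * real (card (runs_ge k w))"
    using sum len by linarith
  finally show "(\<Sum>r\<in>runs_ge k w. run_exponent r) < real (length w) + 2 * real (card (runs_ge k w))" .
qed

theorem theorem3:
  fixes k n :: nat
  assumes "k \<ge> 2" and "n \<ge> 1"
  shows "real (rho TYPE('a) k n) < real n / (real k - 1) \<and>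
         sigma TYPE('a) k n < real n * (real k + 1) / (real k - 1)"
proof
  have k: "real (k - 1) = real k - 1" "real k - 1 > 0" using assms(1) by auto
  have card: "real (card (runs_ge k w)) < real n / (real k - 1)"
    if "length w = n" for w :: "'a list"
  proof -
    have "w \<noteq> []" using that assms(2) by auto
    then have "real ((k - 1) * card (runs_ge k w)) < real n"
      using runs_ge_bounds(1)[of w k] that by (intro less_imp_of_nat_less) simp
    then show ?thesis using k by (simp only: of_nat_mult pos_less_divide_eq mult.commute)
  qed
  show "real (rho TYPE('a) k n) < real n / (real k - 1)"
    using rho_attained[where 'a = 'a, of n k] card by metis
  obtain w :: "'a list" where w: "length w = n"
    "sigma TYPE('a) k n = (\<Sum>r\<in>runs_ge k w. run_exponent r)"
    using sigma_attained by blast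
  have "w \<noteq> []" using w(1) assms(2) by auto
  then have "sigma TYPE('a) k n < real n + 2 * real (card (runs_ge k w))"
    using runs_ge_bounds(2)[of w k] w by simp
  \<comment> \<open>The bound on the number of runs is applied to the very string that attains
    \<open>sigma\<close>.\<close>
  also have "\<dots> < real n + 2 * (real n / (real k - 1))"
    using card[OF w(1)] by simp
  also have "\<dots> = real n * (real k + 1) / (real k - 1)"
    using k(2) by (simp add: field_simps)
  finally show "sigma TYPE('a) k n < real n * (real k + 1) / (real k - 1)" .
qed

end
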